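(* Let $(X,\sigma,T)$ and $(X',\sigma',T)$ be as in the context, both with no extra spectrum, and let $\Phi:E(X)\to E(X')$ be an Ellis morphism. Let $e$ be a minimal idempotent of $E(X)$, $L=E(X)e$, $e'=\Phi(e)$, and let $x\in e\pi_{eq}^{-1}(0)$, $x'\in e'\pi_{eq}'^{-1}(0)$. Suppose that (1) every point lying in a singular fibre $\pi_{eq}^{-1}(\xi)$, $\xi\in X_{eq}^{sing}$, separates the idempotents of $L$; (2) $\widetilde{\Phi_{eq}}(X_{eq}^{reg})\subset X_{eq}'^{reg}$; (3) $\Phi(\mathrm{stab}_{\mathcal G}(x))\subset\mathrm{stab}_{\mathcal G'}(x')$. Then $x\mapsto x'$ extends to a factor map $\phi:(X,\sigma)\to(X',\sigma')$ with $\Phi=\phi_*$.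
   Context: $T$ is an abelian group; $(X,\sigma,T)$, $(X',\sigma',T)$ are continuous minimal non-distal actions on compact Hausdorff spaces. $E(X)$ is the Ellis semigroup (closure of $\{\sigma^t\}$ in $X^X$, pointwise topology, composition) with $T$-action $\sigma_E^t(f)=\sigma^t\circ f$. An Ellis morphism is a continuous monoid morphism $\Phi:E(X)\to E(X')$ with $\Phi(\sigma_E^tf)=\sigma'^t_E\Phi(f)$; a factor map $\phi$ induces $\phi_*(f)(\phi(y))=\phi(f(y))$. Points $x,y$ are proximal if $f(x)=f(y)$ for some $f\in E(X)$. $\pi_{eq}:X\to X_{eq}$ is the maximal equicontinuous factor; $X_{eq}$ is a compact abelian group whose neutral element $0$ is singular; $\xi$ is singular if $\pi_{eq}^{-1}(\xi)$ contains two distinct proximal points, regular otherwise; $X^{sing}_{eq}$, $X^{reg}_{eq}$ are the sets of singular/regular points. $\mathcal G=eL$, $\mathrm{stab}_{\mathcal G}(x)=\{g\in\mathcal G:g(x)=x\}$; $L'=E(X')e'$, $\mathcal G'=e'L'$; primed objects are defined analogously. A point separates the idempotents of $L$ if evaluation at it is injective on the idempotents of $L$. $\tilde\pi_{eq}:L\to X_{eq}$, $\tilde\pi_{eq}(f)=\pi_{eq}(f(y))-\pi_{eq}(y)$; $L^{fib}=\tilde\pi_{eq}^{-1}(0)$, $\mathcal G^{fib}=\mathcal G\cap L^{fib}$; $\Gamma$ is the little structure group (subgroup of $\mathcal G$ generated by the entries of the sandwich matrix of a Rees matrix representation of the kernel of $E(X)$). No extra spectrum: the closure of the normal closure of $\Gamma$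 in $\mathcal G$ equals $\mathcal G^{fib}$; in that case the factor map $\eta_0:L_{eq}\to X_{eq}$ with $\tilde\pi_{eq}=\eta_0\circ\pi^L_{eq}$ (where $\pi^L_{eq}:L\to L_{eq}$ is the maximal equicontinuous factor of $(L,\sigma_E|_L)$) is bijective. $\Phi$ restricts to a factor map $L\to L'$, inducing $\Phi_{eq}:L_{eq}\to L'_{eq}$, and $\widetilde{\Phi_{eq}}:=\eta_0'\circ\Phi_{eq}\circ\eta_0^{-1}:X_{eq}\to X'_{eq}$. *)

theory Defs
  imports "HOL-Analysis.Analysis" "HOL-Algebra.Generated_Groups"
begin

definition action_on :: "'y topology \<Rightarrow> ('t::ab_group_add \<Rightarrow> 'y \<Rightarrow> 'y) \<Rightarrow> bool" where
  "action_on Y \<rho> \<longleftrightarrow>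
     (\<forall>t. continuous_map Y Y (\<rho> t)) \<and>
     (\<forall>y\<in>topspace Y. \<rho> 0 y = y) \<and>
     (\<forall>s t. \<forall>y\<in>topspace Y. \<rho> (s + t) y = \<rho> s (\<rho> t y))"

definition factor_map ::
  "'x topology \<Rightarrow> ('t::ab_group_add \<Rightarrow> 'x \<Rightarrow> 'x) \<Rightarrow> 'y topology \<Rightarrow> ('t \<Rightarrow> 'y \<Rightarrow> 'y) \<Rightarrow> ('x \<Rightarrow> 'y) \<Rightarrow> bool" where
  "factor_map X \<rho> Y \<rho>' \<phi> \<longleftrightarrow>
     continuous_map X Y \<phi> \<and> \<phi> ` topspace X = topspace Y \<and>
     (\<forall>t. \<forall>x\<in>topspace X. \<phi> (\<rho> t x) = \<rho>' t (\<phi> x))"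

text \<open>Equicontinuity on a compact Hausdorff space (its unique uniformity consists of the
  neighbourhoods of the diagonal).\<close>
definition equicontinuous_action :: "'y topology \<Rightarrow> ('t \<Rightarrow> 'y \<Rightarrow> 'y) \<Rightarrow> bool" where
  "equicontinuous_action Y \<rho> \<longleftrightarrow>
     (\<forall>W. openin (prod_topology Y Y) W \<and> (\<forall>y\<in>topspace Y. (y, y) \<in> W) \<longrightarrow>
        (\<exists>V. openin (prod_topology Y Y) V \<and> (\<forall>y\<in>topspace Y. (y, y) \<in> V) \<and>
             (\<forall>t. \<forall>(y, z)\<in>V. (\<rho> t y, \<rho> t z) \<in> W)))"

definition cont_action :: "('t::ab_group_add \<Rightarrow> 'a::topological_space \<Rightarrow> 'a) \<Rightarrow> bool" where
  "cont_action \<sigma> \<longleftrightarrow> compact (UNIV :: 'a set) \<and> action_on euclidean \<sigma>"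

definition minimal_action :: "('t \<Rightarrow> 'a::topological_space \<Rightarrow> 'a) \<Rightarrow> bool" where
  "minimal_action \<sigma> \<longleftrightarrow> (\<forall>x. closure (range (\<lambda>t. \<sigma> t x)) = UNIV)"

definition ellis :: "('t \<Rightarrow> 'a::topological_space \<Rightarrow> 'a) \<Rightarrow> ('a \<Rightarrow> 'a) set" where
  "ellis \<sigma> = closure (range \<sigma>)"

definition proximal :: "('t \<Rightarrow> 'a::topological_space \<Rightarrow> 'a) \<Rightarrow> 'a \<Rightarrow> 'a \<Rightarrow> bool" where
  "proximal \<sigma> x y \<longleftrightarrow> (\<exists>f\<in>ellis \<sigma>. f x = f y)"

definition distal :: "('t \<Rightarrow> 'a::topological_space \<Rightarrow> 'a) \<Rightarrow> bool" where
  "distal \<sigma> \<longleftrightarrow> (\<forall>x y. proximal \<sigma> x y \<longrightarrow> x = y)"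

definition left_ideal :: "('a \<Rightarrow> 'a) set \<Rightarrow> ('a \<Rightarrow> 'a) set \<Rightarrow> bool" where
  "left_ideal E L \<longleftrightarrow> L \<noteq> {} \<and> L \<subseteq> E \<and> (\<forall>f\<in>E. \<forall>g\<in>L. f \<circ> g \<in> L)"

definition minimal_left_ideal :: "('a \<Rightarrow> 'a) set \<Rightarrow> ('a \<Rightarrow> 'a) set \<Rightarrow> bool" where
  "minimal_left_ideal E L \<longleftrightarrow> left_ideal E L \<and> (\<forall>L'. left_ideal E L' \<and> L' \<subseteq> L \<longrightarrow> L' = L)"

definition minimal_idempotent :: "('a \<Rightarrow> 'a) set \<Rightarrow> ('a \<Rightarrow> 'a) \<Rightarrow> bool" where
  "minimal_idempotent E e \<longleftrightarrow> e \<in> E \<and> e \<circ> e = e \<and> (\<exists>L. minimal_left_ideal E L \<and> e \<in> L)"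

definition Lid :: "('a \<Rightarrow> 'a) set \<Rightarrow> ('a \<Rightarrow> 'a) \<Rightarrow> ('a \<Rightarrow> 'a) set" where
  "Lid E e = {f \<circ> e | f. f \<in> E}"

definition Ggrp_carrier :: "('a \<Rightarrow> 'a) set \<Rightarrow> ('a \<Rightarrow> 'a) \<Rightarrow> ('a \<Rightarrow> 'a) set" where
  "Ggrp_carrier E e = {e \<circ> f | f. f \<in> Lid E e}"

definition Ggrp :: "('a \<Rightarrow> 'a) set \<Rightarrow> ('a \<Rightarrow> 'a) \<Rightarrow> ('a \<Rightarrow> 'a) monoid" where
  "Ggrp E e = \<lparr>carrier = Ggrp_carrier E e, monoid.mult = (\<circ>), one = e\<rparr>"

definition stabG :: "('a \<Rightarrow> 'a) set \<Rightarrow> ('a \<Rightarrow> 'a) \<Rightarrow> 'a \<Rightarrow> ('a \<Rightarrow> 'a) set" where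
  "stabG E e x = {g \<in> Ggrp_carrier E e. g x = x}"

text \<open>Little structure group: generated by the entries of the (normalised) sandwich matrix
  of the Rees matrix representation of the kernel, i.e. by the products \<open>v u\<close> of an
  idempotent v of the minimal right ideal \<open>eE\<close> and an idempotent u of the minimal left
  ideal \<open>Ee\<close>.\<close>
definition little_structure_group :: "('a \<Rightarrow> 'a) set \<Rightarrow> ('a \<Rightarrow> 'a) \<Rightarrow> ('a \<Rightarrow> 'a) set" where
  "little_structure_group E e =
     generate (Ggrp E e)
       {v \<circ> u | v u. v \<in> {e \<circ> f | f. f \<in> E} \<and> v \<circ> v = v \<and> u \<in> Lid E e \<and> u \<circ> u = u}"

definition normal_closure :: "('g, 'b) monoid_scheme \<Rightarrow> 'g set \<Rightarrow> 'g set" where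
  "normal_closure G S = \<Inter> {N. normal N G \<and> S \<subseteq> N}"

text \<open>\<open>\<pi>\<close> is the maximal equicontinuous factor of \<open>(X,\<sigma>)\<close>, presented as a compact abelian group
  on which T acts by rotations. Maximality is stated for all equicontinuous factors
  realised on spaces of subsets of X, which covers every factor up to isomorphism
  (a factor is isomorphic to the quotient by its fibres).\<close>
definition max_eq_factor ::
  "('t::ab_group_add \<Rightarrow> 'a::topological_space \<Rightarrow> 'a) \<Rightarrow> ('t \<Rightarrow> 'c::{topological_ab_group_add,t2_space} \<Rightarrow> 'c) \<Rightarrow> ('a \<Rightarrow> 'c) \<Rightarrow> bool" where
  "max_eq_factor \<sigma> \<sigma>eq \<pi> \<longleftrightarrow>
     compact (UNIV :: 'c set) \<and>
     action_on euclidean \<sigma>eq \<and>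
     (\<forall>t \<xi>. \<sigma>eq t \<xi> = \<xi> + \<sigma>eq t 0) \<and>
     factor_map euclidean \<sigma> euclidean \<sigma>eq \<pi> \<and>
     equicontinuous_action euclidean \<sigma>eq \<and>
     (\<forall>(Y :: 'a set topology) \<rho> \<psi>.
        compact_space Y \<and> Hausdorff_space Y \<and> action_on Y \<rho> \<and>
        factor_map euclidean \<sigma> Y \<rho> \<psi> \<and> equicontinuous_action Y \<rho> \<longrightarrow>
        (\<exists>\<theta>. continuous_map euclidean Y \<theta> \<and> (\<forall>x. \<psi> x = \<theta> (\<pi> x))))"

definition singular_pt :: "('t \<Rightarrow> 'a::topological_space \<Rightarrow> 'a) \<Rightarrow> ('a \<Rightarrow> 'c) \<Rightarrow> 'c \<Rightarrow> bool" where
  "singular_pt \<sigma> \<pi> \<xi> \<longleftrightarrow> (\<exists>x y. x \<noteq> y \<and> \<pi> x = \<xi> \<and> \<pi> y = \<xi> \<and> proximal \<sigma> x y)"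

definition regular_pts :: "('t \<Rightarrow> 'a::topological_space \<Rightarrow> 'a) \<Rightarrow> ('a \<Rightarrow> 'c) \<Rightarrow> 'c set" where
  "regular_pts \<sigma> \<pi> = {\<xi>. \<not> singular_pt \<sigma> \<pi> \<xi>}"

text \<open>\<open>\<tilde>\<pi>\<^sub>e\<^sub>q(f) = \<pi>\<^sub>e\<^sub>q(f y) - \<pi>\<^sub>e\<^sub>q(y)\<close> (independent of y); \<open>\<G>\<^sup>f\<^sup>i\<^sup>b = \<G> \<inter> \<tilde>\<pi>\<^sub>e\<^sub>q\<^sup>-\<^sup>1(0)\<close>.\<close>
definition Gfib :: "('t \<Rightarrow> 'a::topological_space \<Rightarrow> 'a) \<Rightarrow> ('a \<Rightarrow> 'c::ab_group_add) \<Rightarrow> ('a \<Rightarrow> 'a) \<Rightarrow> ('a \<Rightarrow> 'a) set" where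
  "Gfib \<sigma> \<pi> e = {g \<in> Ggrp_carrier (ellis \<sigma>) e. \<forall>y. \<pi> (g y) - \<pi> y = 0}"

text \<open>No extra spectrum (for every choice of minimal idempotent e; the condition does not depend
  on this choice). The closure in \<open>\<G>\<close> is taken w.r.t. the topology induced from \<open>E(X)\<close>.\<close>
definition no_extra_spectrum :: "('t \<Rightarrow> 'a::topological_space \<Rightarrow> 'a) \<Rightarrow> ('a \<Rightarrow> 'c::ab_group_add) \<Rightarrow> bool" where
  "no_extra_spectrum \<sigma> \<pi> \<longleftrightarrow>
     (\<forall>e. minimal_idempotent (ellis \<sigma>) e \<longrightarrow>
        closure (normal_closure (Ggrp (ellis \<sigma>) e) (little_structure_group (ellis \<sigma>) e))
          \<inter> Ggrp_carrier (ellis \<sigma>) e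
        = Gfib \<sigma> \<pi> e)"

definition ellis_morphism ::
  "('t::ab_group_add \<Rightarrow> 'a::topological_space \<Rightarrow> 'a) \<Rightarrow> ('t \<Rightarrow> 'b::topological_space \<Rightarrow> 'b) \<Rightarrow> (('a \<Rightarrow> 'a) \<Rightarrow> ('b \<Rightarrow> 'b)) \<Rightarrow> bool" where
  "ellis_morphism \<sigma> \<sigma>' \<Phi> \<longleftrightarrow>
     continuous_on (ellis \<sigma>) \<Phi> \<and> \<Phi> ` ellis \<sigma> \<subseteq> ellis \<sigma>' \<and>
     (\<forall>f\<in>ellis \<sigma>. \<forall>g\<in>ellis \<sigma>. \<Phi> (f \<circ> g) = \<Phi> f \<circ> \<Phi> g) \<and>
     \<Phi> id = id \<and>
     (\<forall>t. \<forall>f\<in>ellis \<sigma>. \<Phi> (\<sigma> t \<circ> f) = \<sigma>' t \<circ> \<Phi> f)"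

end

theory Submission
  imports Defs
begin

text \<open>Every point of X is \<open>f x\<close> for some \<open>f \<in> L\<close>, and the factor map must be
  \<open>f x \<mapsto> \<Phi> f x'\<close>, so everything rests on this being well defined. Write
  \<open>f = u a\<close> and \<open>g = v b\<close> with \<open>a, b \<in> \<G>\<close> and idempotents \<open>u, v \<in> L\<close>. If \<open>f x = g x\<close>, then
  \<open>a x = b x\<close>, so the hypothesis on stabilisers gives \<open>\<Phi> a x' = \<Phi> b x'\<close>, and \<open>u\<close>, \<open>v\<close>
  agree at \<open>y = a x\<close>. If \<open>y\<close> lies in a singular fibre, then \<open>u = v\<close>. Otherwise
  \<open>\<Phi> a x'\<close> lies in a regular fibre, where every idempotent of \<open>E(X')\<close> acts trivially,
  because it moves a point to a proximal one in the same fibre.\<close>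

section \<open>The Ellis semigroup as a compact semigroup\<close>

lemma compact_UNIV_fun:
  assumes "compact (UNIV :: 'a::topological_space set)"
  shows "compact (UNIV :: ('b \<Rightarrow> 'a) set)"
proof -
  have "compact_space (euclidean :: 'a topology)"
    using assms by (simp add: compact_space_def)
  then have "compact_space (product_topology (\<lambda>_::'b. euclidean :: 'a topology) UNIV)"
    by (simp add: compact_space_product_topology)
  then show ?thesis
    by (simp add: euclidean_product_topology compact_space_def)
qed

lemma continuous_on_eval: "continuous_on S (\<lambda>f :: 'b \<Rightarrow> 'a::topological_space. f y)"
  by (rule continuous_on_product_then_coordinatewise[OF continuous_on_id])

text \<open>A condition closed under pointwise convergence passes from the translations
  \<open>\<sigma> t\<close> to all their limits.\<close>

lemma ellis_induct:
  assumes "f \<in> ellis \<sigma>" "closed {f. P f}" "\<And>t. P (\<sigma> t)"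
  shows "P f"
proof -
  have "ellis \<sigma> \<subseteq> {f. P f}"
    unfolding ellis_def by (rule closure_minimal) (use assms in auto)
  then show ?thesis using assms(1) by auto
qed

lemma action_in_ellis: "\<sigma> t \<in> ellis \<sigma>"
  unfolding ellis_def by (rule subsetD[OF closure_subset]) simp

lemma closed_ellis: "closed (ellis \<sigma>)"
  by (simp add: ellis_def)

lemma compact_ellis:
  fixes \<sigma> :: "'t::ab_group_add \<Rightarrow> 'a::t2_space \<Rightarrow> 'a"
  assumes "cont_action \<sigma>"
  shows "compact (ellis \<sigma>)"
proof -
  have "compact (UNIV :: ('a \<Rightarrow> 'a) set)"
    using assms by (intro compact_UNIV_fun) (simp add: cont_action_def)
  then show ?thesis
    using compact_Int_closed[OF _ closed_ellis, of UNIV \<sigma>] by simp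
qed

lemma cont_action_zero:
  assumes "cont_action \<sigma>"
  shows "\<sigma> 0 = id"
  using assms by (auto simp: cont_action_def action_on_def)

lemma id_in_ellis:
  assumes "cont_action \<sigma>"
  shows "id \<in> ellis \<sigma>"
  using action_in_ellis[of \<sigma> 0] cont_action_zero[OF assms] by simp

text \<open>Composition need not be jointly continuous, so limits are taken in one factor at a time.
  With \<open>\<sigma> t\<close> on the left, \<open>g\<close> may vary because
  \<open>\<sigma> t\<close> is continuous; then the left factor may vary, since
  \<open>f \<mapsto> f \<circ> g\<close> is pointwise continuous for every \<open>g\<close>.\<close>

lemma ellis_comp:
  fixes \<sigma> :: "'t::ab_group_add \<Rightarrow> 'a::t2_space \<Rightarrow> 'a"
  assumes act: "cont_action \<sigma>" and f: "f \<in> ellis \<sigma>" and g: "g \<in> ellis \<sigma>"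
  shows "f \<circ> g \<in> ellis \<sigma>"
proof -
  have *: "\<sigma> t \<circ> g \<in> ellis \<sigma>" for t
    using g
  proof (rule ellis_induct)
    have "continuous_on UNIV (\<sigma> t)"
      using act by (simp add: cont_action_def action_on_def)
    then have "continuous_on UNIV (\<lambda>g. \<sigma> t \<circ> g)"
      by (intro continuous_on_coordinatewise_then_product)
         (auto intro: continuous_on_compose2[OF _ continuous_on_eval])
    then show "closed {g. \<sigma> t \<circ> g \<in> ellis \<sigma>}"
      using closed_vimage[OF closed_ellis[of \<sigma>], of "\<lambda>g. \<sigma> t \<circ> g"]
      by (simp add: vimage_def)
    show "\<sigma> t \<circ> \<sigma> s \<in> ellis \<sigma>" for s
    proof -
      have "\<sigma> t \<circ> \<sigma> s = \<sigma> (t + s)"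
        using act by (auto simp: cont_action_def action_on_def)
      then show ?thesis by (simp add: action_in_ellis)
    qed
  qed
  show ?thesis
    using f
  proof (rule ellis_induct)
    have "continuous_on UNIV (\<lambda>f :: 'a \<Rightarrow> 'a. f \<circ> g)"
      by (intro continuous_on_coordinatewise_then_product) (auto intro: continuous_on_eval)
    then show "closed {f. f \<circ> g \<in> ellis \<sigma>}"
      using closed_vimage[OF closed_ellis[of \<sigma>], of "\<lambda>f. f \<circ> g"]
      by (simp add: vimage_def)
  qed (rule *)
qed

lemma compact_Lid:
  fixes \<sigma> :: "'t::ab_group_add \<Rightarrow> 'a::t2_space \<Rightarrow> 'a"
  assumes "cont_action \<sigma>"
  shows "compact (Lid (ellis \<sigma>) e)"
proof -
  have "continuous_on (ellis \<sigma>) (\<lambda>f. f \<circ> e)"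
    by (intro continuous_on_coordinatewise_then_product) (auto intro: continuous_on_eval)
  moreover have "Lid (ellis \<sigma>) e = (\<lambda>f. f \<circ> e) ` ellis \<sigma>"
    by (auto simp: Lid_def)
  ultimately show ?thesis
    using compact_continuous_image compact_ellis[OF assms] by metis
qed

section \<open>Displacement in the maximal equicontinuous factor\<close>

lemma eq_factor_displacement:
  fixes \<pi> :: "'a::t2_space \<Rightarrow> 'c::{topological_ab_group_add,t2_space}"
  assumes mef: "max_eq_factor \<sigma> \<sigma>eq \<pi>" and f: "f \<in> ellis \<sigma>"
  shows "\<pi> (f y) - \<pi> y = \<pi> (f z) - \<pi> z"
  using f
proof (rule ellis_induct)
  have "continuous_on UNIV \<pi>"
    using mef by (simp add: max_eq_factor_def factor_map_def)
  then have "continuous_on UNIV (\<lambda>f :: 'a \<Rightarrow> 'a. \<pi> (f w))" for w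
    by (auto intro: continuous_on_compose2[OF _ continuous_on_eval])
  then show "closed {f. \<pi> (f y) - \<pi> y = \<pi> (f z) - \<pi> z}"
    by (intro closed_Collect_eq continuous_on_diff continuous_on_const)
  \<comment> \<open>Translations cover rotations of the group, so they displace all points
    equally.\<close>
  have "\<pi> (\<sigma> t w) = \<pi> w + \<sigma>eq t 0" for t w
    using mef unfolding max_eq_factor_def factor_map_def by (metis UNIV_I topspace_euclidean)
  then show "\<pi> (\<sigma> t y) - \<pi> y = \<pi> (\<sigma> t z) - \<pi> z" for t
    by simp
qed

text \<open>The displacement of \<open>u\<close> vanishes at the point \<open>u y\<close>, which
  \<open>u\<close> fixes, and it is the same at every point.\<close>

lemma eq_factor_idempotent:
  fixes \<pi> :: "'a::t2_space \<Rightarrow> 'c::{topological_ab_group_add,t2_space}"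
  assumes "max_eq_factor \<sigma> \<sigma>eq \<pi>" "u \<in> ellis \<sigma>" "u \<circ> u = u"
  shows "\<pi> (u y) = \<pi> y"
  using eq_factor_displacement[OF assms(1,2), of "u y" y] fun_cong[OF assms(3), of y] by simp

lemma idempotent_fixes_regular:
  fixes \<pi> :: "'a::t2_space \<Rightarrow> 'c::{topological_ab_group_add,t2_space}"
  assumes "max_eq_factor \<sigma> \<sigma>eq \<pi>" "u \<in> ellis \<sigma>" "u \<circ> u = u" "\<pi> y \<in> regular_pts \<sigma> \<pi>"
  shows "u y = y"
proof (rule ccontr)
  assume "u y \<noteq> y"
  \<comment> \<open>The witness is \<open>u\<close> itself: it sends both points to
    \<open>u y\<close>.\<close>
  moreover have "proximal \<sigma> (u y) y"
    unfolding proximal_def using assms(2) fun_cong[OF assms(3), of y] by auto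
  ultimately show False
    using assms(4) eq_factor_idempotent[OF assms(1-3), of y]
    unfolding regular_pts_def singular_pt_def by blast
qed

section \<open>Algebra of a minimal left ideal and its group\<close>

locale minimal_idempotent_semigroup =
  fixes E :: "('a \<Rightarrow> 'a) set" and e :: "'a \<Rightarrow> 'a"
  assumes comp_closed: "\<And>f g. f \<in> E \<Longrightarrow> g \<in> E \<Longrightarrow> f \<circ> g \<in> E"
    and min_idem: "minimal_idempotent E e"
begin

lemma e_in: "e \<in> E" and e_idem: "e \<circ> e = e"
  using min_idem by (auto simp: minimal_idempotent_def)

lemma LidI: "f \<in> E \<Longrightarrow> f \<circ> e \<in> Lid E e"
  by (auto simp: Lid_def)

lemma e_in_Lid: "e \<in> Lid E e"
  using LidI[OF e_in] e_idem by simp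

lemma Lid_subset: "Lid E e \<subseteq> E"
  using comp_closed e_in by (auto simp: Lid_def)

lemma Lid_absorb: "f \<in> Lid E e \<Longrightarrow> f \<circ> e = f"
  using e_idem by (auto simp: Lid_def comp_assoc)

lemma Lid_comp: "f \<in> E \<Longrightarrow> g \<in> Lid E e \<Longrightarrow> f \<circ> g \<in> Lid E e"
  using LidI[OF comp_closed[of f g]] Lid_subset Lid_absorb[of g] by (auto simp: comp_assoc)

text \<open>Minimality of \<open>e\<close> only provides some minimal left ideal containing
  \<open>e\<close>. It contains the left ideal generated by \<open>e\<close>, hence equals
  it.\<close>

lemma minimal_left_ideal_Lid: "minimal_left_ideal E (Lid E e)"
proof -
  obtain L where L: "minimal_left_ideal E L" "e \<in> L"
    using min_idem by (auto simp: minimal_idempotent_def)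
  have "left_ideal E (Lid E e)"
    unfolding left_ideal_def using e_in_Lid Lid_subset Lid_comp by blast
  moreover have "Lid E e \<subseteq> L"
    using L unfolding minimal_left_ideal_def left_ideal_def by (auto simp: Lid_def)
  ultimately show ?thesis
    using L unfolding minimal_left_ideal_def by metis
qed

text \<open>Right multiplication by \<open>a\<close> turns the minimal left ideal into a left ideal
  inside itself, hence into all of it, and \<open>e\<close> is hit.\<close>

lemma left_divide:
  assumes a: "a \<in> Lid E e"
  obtains b where "b \<in> Lid E e" "b \<circ> a = e"
proof -
  let ?M = "(\<lambda>h. h \<circ> a) ` Lid E e"
  have "left_ideal E ?M"
    unfolding left_ideal_def
  proof (intro conjI ballI)
    show "?M \<noteq> {}" using e_in_Lid by blast
    show "?M \<subseteq> E" using comp_closed Lid_subset a by blast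
    show "f \<circ> g \<in> ?M" if f: "f \<in> E" and g: "g \<in> ?M" for f g
    proof -
      obtain h where h: "h \<in> Lid E e" "g = h \<circ> a" using g by blast
      then have "f \<circ> g = (f \<circ> h) \<circ> a" by (simp add: comp_assoc)
      then show ?thesis using Lid_comp[OF f h(1)] by blast
    qed
  qed
  moreover have "?M \<subseteq> Lid E e" using Lid_comp Lid_subset a by blast
  ultimately have "?M = Lid E e"
    using minimal_left_ideal_Lid unfolding minimal_left_ideal_def by blast
  then show thesis using e_in_Lid that by force
qed

lemma group_carrier_iff: "a \<in> Ggrp_carrier E e \<longleftrightarrow> a \<in> Lid E e \<and> e \<circ> a = a"
proof
  assume "a \<in> Ggrp_carrier E e"
  then obtain f where "f \<in> Lid E e" "a = e \<circ> f" by (auto simp: Ggrp_carrier_def)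
  then show "a \<in> Lid E e \<and> e \<circ> a = a"
    using Lid_comp[OF e_in] e_idem by (simp flip: comp_assoc)
next
  assume "a \<in> Lid E e \<and> e \<circ> a = a"
  then show "a \<in> Ggrp_carrier E e" unfolding Ggrp_carrier_def mem_Collect_eq by metis
qed

text \<open>Multiplying a left inverse from the ideal by \<open>e\<close> on the left moves it into
  the group and leaves the product equal to \<open>e\<close>.\<close>

lemma group_left_inverse:
  assumes "a \<in> Ggrp_carrier E e"
  obtains b where "b \<in> Ggrp_carrier E e" "b \<circ> a = e"
proof -
  obtain b where b: "b \<in> Lid E e" "b \<circ> a = e"
    using left_divide assms group_carrier_iff by blast
  have "e \<circ> b \<in> Ggrp_carrier E e"
    using b(1) by (auto simp: Ggrp_carrier_def)
  moreover have "(e \<circ> b) \<circ> a = e"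
    using b(2) e_idem by (simp add: comp_assoc)
  ultimately show thesis using that by blast
qed

text \<open>A left inverse \<open>c\<close> of the left inverse \<open>b\<close> satisfies
  \<open>c = c \<circ> (b \<circ> a) = (c \<circ> b) \<circ> a = a\<close>, so \<open>b\<close> is
  two-sided.\<close>

lemma group_inverse:
  assumes a: "a \<in> Ggrp_carrier E e"
  obtains b where "b \<in> Ggrp_carrier E e" "b \<circ> a = e" "a \<circ> b = e"
proof -
  obtain b where b: "b \<in> Ggrp_carrier E e" "b \<circ> a = e"
    using group_left_inverse[OF a] by blast
  obtain c where c: "c \<in> Ggrp_carrier E e" "c \<circ> b = e"
    using group_left_inverse[OF b(1)] by blast
  have "c = c \<circ> (b \<circ> a)"
    using c(1) b(2) group_carrier_iff Lid_absorb by simp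
  also have "\<dots> = e \<circ> a"
    using c(2) by (simp flip: comp_assoc)
  also have "\<dots> = a"
    using a group_carrier_iff by simp
  finally show thesis using that b c by blast
qed

text \<open>With \<open>b\<close> the inverse of \<open>a = e \<circ> f\<close>, the idempotent is
  \<open>f \<circ> b\<close>: it squares to itself because
  \<open>b \<circ> f = b \<circ> e \<circ> f = e\<close>. The formula for \<open>a\<close> is
  exported because it shows that \<open>a x\<close> depends only on \<open>f x\<close>.\<close>

lemma idempotent_times_group:
  assumes f: "f \<in> Lid E e"
  obtains u a where "u \<in> Lid E e" "u \<circ> u = u" "a \<in> Ggrp_carrier E e" "a = e \<circ> f" "f = u \<circ> a"
proof -
  define a where "a = e \<circ> f"
  have a: "a \<in> Ggrp_carrier E e"
    using f by (auto simp: a_def Ggrp_carrier_def)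
  obtain b where b: "b \<in> Ggrp_carrier E e" "b \<circ> a = e" "a \<circ> b = e"
    using group_inverse[OF a] by blast
  have bL: "b \<in> Lid E e" and be: "b \<circ> e = b" and eb: "e \<circ> b = b"
    using b(1) group_carrier_iff Lid_absorb by auto
  have fe: "f \<circ> e = f" by (rule Lid_absorb[OF f])
  have bf: "b \<circ> f = e"
    using b(2) be by (simp add: a_def flip: comp_assoc)
  have "f \<circ> b \<in> Lid E e"
    using Lid_comp[OF _ bL] f Lid_subset by blast
  moreover have "(f \<circ> b) \<circ> (f \<circ> b) = f \<circ> b"
  proof -
    have "(f \<circ> b) \<circ> (f \<circ> b) = f \<circ> ((b \<circ> f) \<circ> b)" by (simp add: comp_assoc)
    then show ?thesis by (simp add: bf eb)
  qed
  moreover have "f = (f \<circ> b) \<circ> a"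
    using b(2) fe by (simp add: comp_assoc)
  ultimately show thesis using that a a_def by blast
qed

end

theorem mainTheorem8:
  fixes \<sigma> :: "'t::ab_group_add \<Rightarrow> 'a::t2_space \<Rightarrow> 'a"
    and \<sigma>' :: "'t \<Rightarrow> 'b::t2_space \<Rightarrow> 'b"
    and \<sigma>eq :: "'t \<Rightarrow> 'c::{topological_ab_group_add,t2_space} \<Rightarrow> 'c"
    and \<sigma>eq' :: "'t \<Rightarrow> 'd::{topological_ab_group_add,t2_space} \<Rightarrow> 'd"
    and \<pi> :: "'a \<Rightarrow> 'c" and \<pi>' :: "'b \<Rightarrow> 'd"
    and \<Phi> :: "('a \<Rightarrow> 'a) \<Rightarrow> ('b \<Rightarrow> 'b)"
    and e :: "'a \<Rightarrow> 'a" and x :: 'a and x' :: 'b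
  assumes X: "cont_action \<sigma>" "minimal_action \<sigma>" "\<not> distal \<sigma>"
    and X': "cont_action \<sigma>'" "minimal_action \<sigma>'" "\<not> distal \<sigma>'"
    and eqX: "max_eq_factor \<sigma> \<sigma>eq \<pi>" "singular_pt \<sigma> \<pi> 0"
    and eqX': "max_eq_factor \<sigma>' \<sigma>eq' \<pi>'" "singular_pt \<sigma>' \<pi>' 0"
    and nes: "no_extra_spectrum \<sigma> \<pi>" "no_extra_spectrum \<sigma>' \<pi>'"
    and \<Phi>: "ellis_morphism \<sigma> \<sigma>' \<Phi>"
    and e: "minimal_idempotent (ellis \<sigma>) e"
    and x: "x \<in> e ` (\<pi> -` {0})"
    and x': "x' \<in> \<Phi> e ` (\<pi>' -` {0})"
    and h1: "\<forall>\<xi>. singular_pt \<sigma> \<pi> \<xi> \<longrightarrow> (\<forall>y. \<pi> y = \<xi> \<longrightarrow>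
               inj_on (\<lambda>u. u y) {u \<in> Lid (ellis \<sigma>) e. u \<circ> u = u})"
    and h2: "\<forall>f\<in>Lid (ellis \<sigma>) e. \<forall>y y'.
               \<pi> (f y) - \<pi> y \<in> regular_pts \<sigma> \<pi> \<longrightarrow>
               \<pi>' (\<Phi> f y') - \<pi>' y' \<in> regular_pts \<sigma>' \<pi>'"
    and h3: "\<Phi> ` stabG (ellis \<sigma>) e x \<subseteq> stabG (ellis \<sigma>') (\<Phi> e) x'"
  shows "\<exists>\<phi>. factor_map euclidean \<sigma> euclidean \<sigma>' \<phi> \<and> \<phi> x = x' \<and>
           (\<forall>f\<in>ellis \<sigma>. \<forall>y. \<Phi> f (\<phi> y) = \<phi> (f y))"
proof -
  let ?E = "ellis \<sigma>" and ?G = "Ggrp_carrier (ellis \<sigma>) e"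
  define L where "L = Lid ?E e"
  interpret minimal_idempotent_semigroup ?E e
    using ellis_comp[OF X(1)] e by unfold_locales
  have LE: "f \<in> ?E" if "f \<in> L" for f
    using that Lid_subset by (auto simp: L_def)
  have GL: "a \<in> L" if "a \<in> ?G" for a
    using that group_carrier_iff by (simp add: L_def)
  have \<Phi>_in: "\<Phi> f \<in> ellis \<sigma>'" if "f \<in> ?E" for f
    using \<Phi> that by (auto simp: ellis_morphism_def)
  have \<Phi>_comp: "\<Phi> (f \<circ> g) = \<Phi> f \<circ> \<Phi> g" if "f \<in> ?E" "g \<in> ?E" for f g
    using \<Phi> that by (auto simp: ellis_morphism_def)
  \<comment> \<open>Equivariance at \<open>id\<close>, together with
    \<open>\<Phi> id = id\<close>.\<close>
  have \<Phi>_\<sigma>: "\<Phi> (\<sigma> t) = \<sigma>' t" for t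
    using \<Phi> id_in_ellis[OF X(1)] unfolding ellis_morphism_def by (metis comp_id)
  have \<Phi>_idem: "\<Phi> u \<circ> \<Phi> u = \<Phi> u" if "u \<in> ?E" "u \<circ> u = u" for u
    using \<Phi>_comp[of u u] that by simp
  \<comment> \<open>Here \<open>x = e z\<close> with \<open>\<pi> z = 0\<close>; the idempotent
    \<open>e\<close> fixes its image and preserves fibres. The same holds for \<open>x'\<close> and
    \<open>\<Phi> e\<close>.\<close>
  have ex: "e x = x" and \<pi>x: "\<pi> x = 0"
    using x fun_cong[OF e_idem] eq_factor_idempotent[OF eqX(1) e_in e_idem] by auto
  have ex': "\<Phi> e x' = x'" and \<pi>x': "\<pi>' x' = 0"
    using x' fun_cong[OF \<Phi>_idem[OF e_in e_idem]]
      eq_factor_idempotent[OF eqX'(1) \<Phi>_in[OF e_in] \<Phi>_idem[OF e_in e_idem]] by auto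

  \<comment> \<open>Independence of the representative in \<open>L\<close>\<close>
  have well_defined: "\<Phi> f x' = \<Phi> g x'" if f: "f \<in> L" and g: "g \<in> L" and fg: "f x = g x" for f g
  proof -
    obtain u a where u: "u \<in> L" "u \<circ> u = u" and a: "a \<in> ?G" "a = e \<circ> f" "f = u \<circ> a"
      using idempotent_times_group f unfolding L_def by blast
    obtain v b where v: "v \<in> L" "v \<circ> v = v" and b: "b \<in> ?G" "b = e \<circ> g" "g = v \<circ> b"
      using idempotent_times_group g unfolding L_def by blast
    have ab: "a x = b x" using a(2) b(2) fg by simp
    obtain c where c: "c \<in> ?G" "c \<circ> b = e" "b \<circ> c = e"
      using group_inverse[OF b(1)] by blast
    \<comment> \<open>As \<open>c\<close> inverts \<open>b\<close>, the quotient
      \<open>c \<circ> a\<close> stabilises \<open>x\<close> and \<open>h3\<close> applies to it.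
      Multiplying back by \<open>b\<close> then compares \<open>\<Phi> a x'\<close> with
      \<open>\<Phi> b x'\<close>.\<close>
    have "c \<circ> a \<in> ?G"
      using c(1) a(1) Lid_comp LE[OF GL] group_carrier_iff by (simp flip: comp_assoc)
    moreover have "(c \<circ> a) x = x"
      using ab ex fun_cong[OF c(2), of x] by simp
    ultimately have "\<Phi> (c \<circ> a) x' = x'"
      using h3 unfolding stabG_def by blast
    moreover have "b \<circ> (c \<circ> a) = a"
      using c(3) a(1) group_carrier_iff by (simp flip: comp_assoc)
    ultimately have \<Phi>ab: "\<Phi> a x' = \<Phi> b x'"
      using \<Phi>_comp[of b "c \<circ> a"] LE[OF GL] b(1) \<open>c \<circ> a \<in> ?G\<close> by simp
    have "\<Phi> u (\<Phi> a x') = \<Phi> v (\<Phi> a x')"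
    proof (cases "singular_pt \<sigma> \<pi> (\<pi> (a x))")
      case True
      have "u (a x) = v (a x)" using fg a(3) b(3) ab by simp
      then have "u = v"
        using h1 True u v unfolding inj_on_def L_def by blast
      then show ?thesis by simp
    next
      case False
      \<comment> \<open>\<open>h2\<close> expresses hypothesis (2) through displacements: the map
        induced by \<Phi> on the equicontinuous factors takes the displacement of \<open>f\<close>
        to that of \<open>\<Phi> f\<close>. As \<open>x\<close> and \<open>x'\<close> lie over 0,
        the displacements of \<open>a\<close> and \<open>\<Phi> a\<close> are the base points of
        \<open>a x\<close> and \<open>\<Phi> a x'\<close>.\<close>
      then have "\<pi> (a x) - \<pi> x \<in> regular_pts \<sigma> \<pi>"
        by (simp add: \<pi>x regular_pts_def)
      then have "\<pi>' (\<Phi> a x') \<in> regular_pts \<sigma>' \<pi>'"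
        using h2 GL[OF a(1)] \<pi>x' unfolding L_def by (metis diff_zero)
      then have "\<Phi> w (\<Phi> a x') = \<Phi> a x'" if "w \<in> L" "w \<circ> w = w" for w
        using idempotent_fixes_regular[OF eqX'(1) \<Phi>_in \<Phi>_idem] LE that by blast
      then show ?thesis using u v by simp
    qed
    moreover have "\<Phi> f x' = \<Phi> u (\<Phi> a x')"
      using \<Phi>_comp[of u a] LE[OF GL] LE u a(1,3) by simp
    moreover have "\<Phi> g x' = \<Phi> v (\<Phi> b x')"
      using \<Phi>_comp[of v b] LE[OF GL] LE v b(1,3) by simp
    ultimately show ?thesis using \<Phi>ab by simp
  qed

  \<comment> \<open>Construction of the factor map\<close>
  have L_compact: "compact L"
    unfolding L_def by (rule compact_Lid[OF X(1)])
  have onto: "\<exists>f\<in>L. f x = y" for y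
  proof -
    \<comment> \<open>Since \<open>e x = x\<close>, the element \<open>\<sigma> t \<circ> e\<close>
      of \<open>L\<close> reaches \<open>\<sigma> t x\<close>. The image of evaluation is compact
      and contains a dense orbit.\<close>
    have "\<sigma> t x \<in> (\<lambda>f. f x) ` L" for t
      by (rule image_eqI[where x = "\<sigma> t \<circ> e"]) (simp_all add: ex L_def LidI action_in_ellis)
    moreover have "closed ((\<lambda>f. f x) ` L)"
      by (intro compact_imp_closed compact_continuous_image continuous_on_eval L_compact)
    ultimately have "closure (range (\<lambda>t. \<sigma> t x)) \<subseteq> (\<lambda>f. f x) ` L"
      by (intro closure_minimal) auto
    moreover have "y \<in> closure (range (\<lambda>t. \<sigma> t x))"
      using X(2) by (simp add: minimal_action_def)
    ultimately have "y \<in> (\<lambda>f. f x) ` L" by (rule subsetD)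
    then show ?thesis by auto
  qed

  \<comment> \<open>A suitable \<open>f\<close> exists by \<open>onto\<close>, and
    \<open>well_defined\<close> makes the value independent of the choice.\<close>
  define \<phi> where "\<phi> y = \<Phi> (SOME f. f \<in> L \<and> f x = y) x'" for y
  have \<phi>: "\<phi> (f x) = \<Phi> f x'" if "f \<in> L" for f
  proof -
    have "(SOME g. g \<in> L \<and> g x = f x) \<in> L \<and> (SOME g. g \<in> L \<and> g x = f x) x = f x"
      by (rule someI[of _ f]) (use that in simp)
    then show ?thesis
      unfolding \<phi>_def using well_defined that by blast
  qed
  \<comment> \<open>This is the identity between \<Phi> and the morphism induced by \<phi>; at
    \<open>f = \<sigma> t\<close> it gives equivariance under the action.\<close>
  have equivariant: "\<Phi> f (\<phi> y) = \<phi> (f y)" if "f \<in> ?E" for f y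
  proof -
    obtain g where g: "g \<in> L" "g x = y" using onto by blast
    have "f \<circ> g \<in> L" using Lid_comp[OF that] g(1) by (simp add: L_def)
    then show ?thesis
      using \<phi>[of "f \<circ> g"] \<phi>[OF g(1)] g \<Phi>_comp[OF that LE[OF g(1)]] by simp
  qed
  have \<phi>x: "\<phi> x = x'"
    using \<phi>[of e] e_in_Lid ex ex' by (simp add: L_def)

  \<comment> \<open>Continuity and surjectivity\<close>
  have continuous: "continuous_on UNIV \<phi>"
  proof -
    \<comment> \<open>Evaluation at \<open>x\<close> maps the compact \<open>L\<close> onto a
      Hausdorff space, so it is a closed map. Continuity of \<phi> thus reduces to that of
      \<open>f \<mapsto> \<Phi> f x'\<close> on \<open>L\<close>.\<close>
    have "closed (\<phi> -` C)" if C: "closed C" for C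
    proof -
      have "continuous_on L \<Phi>"
        using \<Phi> LE unfolding ellis_morphism_def by (meson continuous_on_subset subsetI)
      then have "continuous_on L (\<lambda>f. \<Phi> f x')"
        by (rule continuous_on_product_then_coordinatewise)
      then have "closedin (top_of_set L) (L \<inter> (\<lambda>f. \<Phi> f x') -` C)"
        using C continuous_closedin_preimage by blast
      then have "compact (L \<inter> (\<lambda>f. \<Phi> f x') -` C)"
        using L_compact closedin_compact by blast
      then have "closed ((\<lambda>f. f x) ` (L \<inter> (\<lambda>f. \<Phi> f x') -` C))"
        by (intro compact_imp_closed compact_continuous_image continuous_on_eval)
      moreover have "(\<lambda>f. f x) ` (L \<inter> (\<lambda>f. \<Phi> f x') -` C) = \<phi> -` C"
      proof (intro equalityI subsetI)
        fix y assume "y \<in> \<phi> -` C"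
        then show "y \<in> (\<lambda>f. f x) ` (L \<inter> (\<lambda>f. \<Phi> f x') -` C)"
          using onto[of y] \<phi> by force
      qed (use \<phi> in auto)
      ultimately show ?thesis by simp
    qed
    then show ?thesis
      by (simp add: continuous_on_closed_vimage)
  qed
  have surj: "range \<phi> = UNIV"
  proof -
    \<comment> \<open>A compact, hence closed, image containing the orbit of \<open>x'\<close> is
      everything by minimality.\<close>
    have "closed (range \<phi>)"
      using compact_continuous_image[OF continuous] X(1)
      by (auto simp: cont_action_def intro: compact_imp_closed)
    moreover have "\<sigma>' t x' \<in> range \<phi>" for t
      using equivariant[OF action_in_ellis, of t x] \<phi>x \<Phi>_\<sigma> by (metis rangeI)
    ultimately have "closure (range (\<lambda>t. \<sigma>' t x')) \<subseteq> range \<phi>"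
      by (intro closure_minimal) auto
    then show ?thesis
      using X'(2) unfolding minimal_action_def by auto
  qed
  have "factor_map euclidean \<sigma> euclidean \<sigma>' \<phi>"
    using continuous surj equivariant[OF action_in_ellis] \<Phi>_\<sigma>
    by (simp add: factor_map_def)
  then show ?thesis
    using \<phi>x equivariant by blast
qed

end
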